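(* Let $m$ be a positive integer. (i) Assume that $p = 2m+1$ is a prime congruent to $3$ modulo $4$. Then $T_m$ cannot be written in the form $x^2+y^2+T_z$ with $x,y,z\in\mathbb{Z}$, $x^2+y^2>0$ and $x\equiv y \pmod 2$. Also, $2T_m$ cannot be written as $x^2 + T_y + T_z$ with $x,y,z\in\mathbb{Z}$, $x$ even and $x\neq 0$. (ii) Assume that all prime divisors of $2m+1$ are congruent to $1$ modulo $4$. Then $T_m$ cannot be written as $x^2+y^2+T_z$ with $x,y,z\in\mathbb{Z}$, $x$ odd and $y$ even. Also, $2T_m$ cannot be written as $x^2+T_y+T_z$ with $x,y,z\in\mathbb{Z}$ and $x$ odd.
   Context: For $x\in\mathbb{Z}$, the triangular number $T_x$ is $T_x = x(x+1)/2$. *)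

theory Defs
  imports "HOL-Number_Theory.Number_Theory"
begin

text \<open>The division below is exact, since \<open>x * (x + 1)\<close> is always even.\<close>
definition T :: "int \<Rightarrow> int" where
  "T x = x * (x + 1) div 2"

end

theory Submission
  imports Defs
begin

text \<open>
  With \<open>n = 2 m + 1\<close>, both kinds of representation become \<open>n\<^sup>2 = w\<^sup>2 + 4 (s\<^sup>2 + t\<^sup>2)\<close>, that is
  \<open>a b = s\<^sup>2 + t\<^sup>2\<close> with \<open>a = (n - w) / 2\<close>, \<open>b = (n + w) / 2\<close> and \<open>a + b = n\<close>. If \<open>a\<close> and \<open>b\<close> have no common prime
  factor congruent to 3 modulo 4, then such primes divide the odd one of \<open>a, b\<close> to an even power,
  so that it is 1 modulo 4, the other one is \<open>s\<^sup>2 + t\<^sup>2\<close> modulo 4, and hence \<open>n\<close> is \<open>1 + s\<^sup>2 + t\<^sup>2\<close>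
  modulo 4.
\<close>

text \<open>If \<open>q\<close> divided only one of \<open>x\<close>, \<open>y\<close>, it could not
  divide the sum. If it divided neither, raising \<open>x^2 \<equiv> - y^2\<close> to the odd power
  \<open>(q - 1) / 2\<close> would, by Fermat, give 1 \<equiv> -1 modulo \<open>q\<close>.\<close>

lemma prime_3_mod_4_dvd_sum_squares:
  fixes q x y :: int
  assumes "prime q" "[q = 3] (mod 4)" "q dvd x\<^sup>2 + y\<^sup>2"
  shows "q dvd x"
proof (rule ccontr)
  assume x: "\<not> q dvd x"
  have q: "q \<ge> 2" using assms(1) by (simp add: prime_ge_2_int)
  define k where "k = nat (q div 4)"
  \<comment> \<open>Hence \<open>q - 1 = 4 * k + 2\<close>, the Fermat exponent, and its half
    \<open>2 * k + 1\<close> is odd.\<close>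
  have qk: "q = 4 * int k + 3"
    using assms(2) q unfolding k_def cong_def by (simp add: div_mult_mod_eq) presburger
  have pq: "prime (nat q)" using assms(1) by simp
  have y: "\<not> q dvd y"
  proof
    assume "q dvd y"
    then have "q dvd y\<^sup>2" by (simp add: power2_eq_square)
    then have "q dvd x\<^sup>2" using assms(3) by (simp add: dvd_add_left_iff)
    then show False using x assms(1) prime_dvd_power by blast
  qed
  have fermat: "[z ^ (4 * k + 2) = 1] (mod q)" if "\<not> q dvd z" for z
  proof -
    interpret residues q "residue_ring q" by unfold_locales (use q in auto)
    have "coprime z q"
      using that assms(1) prime_imp_coprime[of q z] by (simp add: coprime_commute)
    then have "[z ^ totient (nat q) = 1] (mod q)"
      by (rule euler_theorem)
    moreover have "totient (nat q) = 4 * k + 2"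
      using pq qk by (simp add: totient_prime)
    ultimately show ?thesis by simp
  qed
  have "[x\<^sup>2 = - y\<^sup>2] (mod q)"
    using assms(3) by (simp add: cong_iff_dvd_diff)
  then have "[(x\<^sup>2) ^ (2 * k + 1) = (- y\<^sup>2) ^ (2 * k + 1)] (mod q)"
    by (rule cong_pow)
  moreover have "(- y\<^sup>2) ^ (2 * k + 1) = - (y ^ (4 * k + 2))"
    using power_mult[of y 2 "2 * k + 1"] by simp
  moreover have "(x\<^sup>2) ^ (2 * k + 1) = x ^ (4 * k + 2)"
    using power_mult[of x 2 "2 * k + 1"] by simp
  ultimately have "[x ^ (4 * k + 2) = - (y ^ (4 * k + 2))] (mod q)"
    by simp
  then have "[1 = - 1] (mod q)"
    using cong_trans[OF cong_sym[OF fermat[OF x]]] cong_trans cong_minus_minus_iff[THEN iffD2, OF fermat[OF y]] by blast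
  then have "q dvd 2" by (simp add: cong_iff_dvd_diff)
  then show False using zdvd_imp_le[of q 2] qk by simp
qed

text \<open>Strong induction strips prime factors off \<open>a\<close>. A prime 1 modulo 4 is moved
  into \<open>b\<close>, so the product stays the same sum of squares. A prime 3 modulo 4 leaves
  \<open>a\<close> in pairs, and its square is 1 modulo 4.\<close>

lemma odd_factor_of_sum_squares_cong_1:
  fixes a b x y :: int
  assumes "a > 0" "odd a" "a * b = x\<^sup>2 + y\<^sup>2"
    and "\<And>q. prime q \<Longrightarrow> [q = 3] (mod 4) \<Longrightarrow> q dvd a \<Longrightarrow> \<not> q dvd b"
  shows "[a = 1] (mod 4)"
  using assms
proof (induction "nat a" arbitrary: a b x y rule: less_induct)
  case less
  show ?case
  proof (cases "a = 1")
    case False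
    then obtain q where q: "prime q" "q dvd a"
      using prime_divisor_exists[of a] less.prems(1) by auto
    have q2: "q \<ge> 2" using q(1) by (simp add: prime_ge_2_int)
    obtain c where c: "a = q * c" using q(2) by blast
    have c0: "c > 0" using c less.prems(1) q2 by (simp add: zero_less_mult_iff)
    have "odd q" using c less.prems(2) by simp
    then have "q mod 4 = 1 \<or> q mod 4 = 3" by presburger
    then consider "[q = 1] (mod 4)" | "[q = 3] (mod 4)"
      by (auto simp: cong_def)
    then show ?thesis
    proof cases
      case 1
      have "[c = 1] (mod 4)"
      proof (rule less.hyps)
        show "nat c < nat a" using c c0 q2 by (simp add: nat_less_eq_zless)
        show "c * (q * b) = x\<^sup>2 + y\<^sup>2" using less.prems(3) c by (simp add: algebra_simps)
        show "odd c" using c less.prems(2) by simp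
        \<comment> \<open>Moving \<open>q\<close> over creates no forbidden common prime, since
          \<open>q\<close> is 1 modulo 4.\<close>
        show "\<not> r dvd q * b" if r: "prime r" "[r = 3] (mod 4)" "r dvd c" for r
        proof -
          have "r \<noteq> q" using 1 r(2) by (auto simp: cong_def)
          then have "\<not> r dvd q" using r(1) q(1) primes_dvd_imp_eq by blast
          moreover have "\<not> r dvd b" using less.prems(4) r c by simp
          ultimately show ?thesis using r(1) by (simp add: prime_dvd_mult_iff)
        qed
      qed (rule c0)
      with 1 show ?thesis unfolding c using cong_mult[of q 1 4 c 1] by simp
    next
      case 2
      have dv: "q dvd x\<^sup>2 + y\<^sup>2" using dvd_mult2[OF q(2), of b] less.prems(3) by simp
      have "q dvd x"
        using dv by (rule prime_3_mod_4_dvd_sum_squares[OF q(1) 2])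
      moreover have "q dvd y"
        using dv by (intro prime_3_mod_4_dvd_sum_squares[OF q(1) 2, of y x]) (simp add: add.commute)
      ultimately obtain u v where uv: "x = q * u" "y = q * v" by (elim dvdE)
      have "q * (c * b) = q * (q * (u\<^sup>2 + v\<^sup>2))"
        using less.prems(3) unfolding c uv by (simp add: power2_eq_square algebra_simps)
      then have cb: "c * b = q * (u\<^sup>2 + v\<^sup>2)" using q2 by simp
      then have "q dvd c * b" by simp
      \<comment> \<open>As \<open>q\<close> already divides \<open>a\<close>, it cannot divide
        \<open>b\<close>, so the second factor \<open>q\<close> lies in \<open>a\<close> as
        well.\<close>
      then have "q dvd c" using less.prems(4)[OF q(1) 2 q(2)] q(1) by (simp add: prime_dvd_mult_iff)
      then obtain d where d: "c = q * d" by blast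
      have d0: "d > 0" using d c0 q2 by (simp add: zero_less_mult_iff)
      have "[d = 1] (mod 4)"
      proof (rule less.hyps)
        have "d < c" using d d0 q2 by simp
        also have "c < a" using c c0 q2 by simp
        finally show "nat d < nat a" using d0 by simp
        show "d * b = u\<^sup>2 + v\<^sup>2" using cb d q2 by simp
        show "odd d" using c d less.prems(2) by simp
        show "\<not> r dvd b" if "prime r" "[r = 3] (mod 4)" "r dvd d" for r
          using less.prems(4) that c d by simp
      qed (rule d0)
      moreover have "[q * q = 1] (mod 4)"
        using cong_mult[OF 2 2] by (simp add: cong_def)
      ultimately show ?thesis
        unfolding c d using cong_mult[of "q * q" 1 4 d 1] by (simp add: mult.assoc)
    qed
  qed simp
qed

lemma sum_of_factors_of_sum_squares_mod_4:
  fixes a b s t :: int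
  assumes "a > 0" "b > 0" "odd (a + b)" "a * b = s\<^sup>2 + t\<^sup>2"
    and no_common: "\<And>q. prime q \<Longrightarrow> [q = 3] (mod 4) \<Longrightarrow> q dvd a \<Longrightarrow> \<not> q dvd b"
  shows "[a + b = 1 + s\<^sup>2 + t\<^sup>2] (mod 4)"
proof (cases "odd a")
  case True
  have a: "[a = 1] (mod 4)"
    using odd_factor_of_sum_squares_cong_1[OF assms(1) True assms(4)] no_common by blast
  show ?thesis
    \<comment> \<open>Multiplying \<open>a \<equiv> 1\<close> by \<open>b\<close> gives
      \<open>b \<equiv> a * b\<close>, the sum of squares.\<close>
    using cong_add[OF a cong_sym[OF cong_scalar_right[OF a, of b]]] assms(4) by (simp add: add.assoc)
next
  case False
  then have "odd b" using assms(3) by simp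
  have "b * a = s\<^sup>2 + t\<^sup>2" using assms(4) by (simp add: mult.commute)
  then have b: "[b = 1] (mod 4)"
    using odd_factor_of_sum_squares_cong_1[OF assms(2) \<open>odd b\<close>] no_common by blast
  show ?thesis
    using cong_add[OF b cong_sym[OF cong_scalar_left[OF b, of a]]] assms(4)
    by (simp add: ac_simps)
qed

text \<open>The hypothesis on primes covers both settings: \<open>n\<close> itself prime, or
  \<open>n\<close> without prime factors 3 modulo 4. A prime dividing both \<open>a\<close> and
  \<open>b\<close> divides their sum \<open>n\<close>, so it would equal \<open>n\<close>, yet
  \<open>0 < a < n\<close>.\<close>

lemma square_eq_square_plus_4_sum_squares_mod_4:
  fixes n w s t :: int
  assumes "n > 0" "odd n" "n\<^sup>2 = w\<^sup>2 + 4 * (s\<^sup>2 + t\<^sup>2)" "s\<^sup>2 + t\<^sup>2 > 0"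
    and no_common: "\<And>q. prime q \<Longrightarrow> [q = 3] (mod 4) \<Longrightarrow> q dvd n \<Longrightarrow> q = n"
  shows "[n = 1 + s\<^sup>2 + t\<^sup>2] (mod 4)"
proof -
  have "odd (w\<^sup>2)" using assms(2,3) by (metis even_add even_mult_iff even_numeral even_power zero_less_numeral)
  then have "even (n - w)" using assms(2) by simp
  then obtain a where a: "n - w = 2 * a" by blast
  define b where "b = n - a"
  have ab: "a * b = s\<^sup>2 + t\<^sup>2"
  proof -
    have w: "w = n - 2 * a" using a by simp
    have "4 * (a * b) = 4 * (s\<^sup>2 + t\<^sup>2)"
      using assms(3) unfolding b_def w by (simp add: power2_eq_square algebra_simps)
    then show ?thesis by simp
  qed
  have sum: "a + b = n" by (simp add: b_def)
  \<comment> \<open>The product and the sum of \<open>a\<close> and \<open>b\<close> are both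
    positive.\<close>
  have pos: "a > 0" "b > 0"
    using ab assms(1,4) sum by (smt (verit) zero_less_mult_iff)+
  have "\<not> q dvd b" if "prime q" "[q = 3] (mod 4)" "q dvd a" for q
  proof
    assume "q dvd b"
    then have "q dvd n" using that(3) sum by (metis dvd_add)
    then have "q = n" using no_common that by blast
    then show False using that(3) pos sum zdvd_imp_le by fastforce
  qed
  then show ?thesis
    using sum_of_factors_of_sum_squares_mod_4[OF pos _ ab] assms(2) sum by simp
qed

lemma eight_T: "8 * T x = (2 * x + 1)\<^sup>2 - 1"
proof -
  have "2 * T x = x * (x + 1)" unfolding T_def by simp
  then show ?thesis by (simp add: power2_eq_square algebra_simps)
qed

text \<open>Multiply by 8 and use \<open>2 * (x^2 + y^2) = (x + y)^2 + (x - y)^2\<close>.\<close>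

lemma T_eq_sum_squares_plus_T:
  assumes "T m = x\<^sup>2 + y\<^sup>2 + T z"
  shows "(2 * m + 1)\<^sup>2 = (2 * z + 1)\<^sup>2 + 4 * ((x + y)\<^sup>2 + (x - y)\<^sup>2)"
  using assms eight_T[of m] eight_T[of z] by (simp add: power2_eq_square algebra_simps)

lemma double_T_eq_square_plus_T_plus_T:
  assumes "2 * T m = x\<^sup>2 + T y + T z"
  obtains w t where "(2 * m + 1)\<^sup>2 = w\<^sup>2 + 4 * (x\<^sup>2 + t\<^sup>2)" "even (x + t)"
proof -
  \<comment> \<open>The half-sum of the squares of \<open>2 * y + 1\<close> and
    \<open>2 * z + 1\<close> is rewritten through their half-sum and half-difference. These have
    opposite parity: the even one becomes \<open>2 * t\<close>, the odd one
    \<open>w\<close>.\<close>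
  have eq: "(2 * m + 1)\<^sup>2 = (y + z + 1)\<^sup>2 + (y - z)\<^sup>2 + 4 * x\<^sup>2"
    using assms eight_T[of m] eight_T[of y] eight_T[of z] by (simp add: power2_eq_square algebra_simps)
  have "\<exists>w t. (2 * m + 1)\<^sup>2 = w\<^sup>2 + 4 * (x\<^sup>2 + t\<^sup>2)"
  proof (cases "even (y - z)")
    case True
    then obtain t where "y - z = 2 * t" by blast
    then show ?thesis using eq by (intro exI[of _ "y + z + 1"] exI[of _ t]) (simp add: power2_eq_square)
  next
    case False
    then have "even (y + z + 1)" by simp
    then obtain t where "y + z + 1 = 2 * t" by blast
    then show ?thesis using eq by (intro exI[of _ "y - z"] exI[of _ t]) (simp add: power2_eq_square)
  qed
  then obtain w t where wt: "(2 * m + 1)\<^sup>2 = w\<^sup>2 + 4 * (x\<^sup>2 + t\<^sup>2)" by blast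
  \<comment> \<open>Two odd squares differ by a multiple of 8, so \<open>x^2 + t^2\<close> is even
    and \<open>t\<close> has the parity of \<open>x\<close>.\<close>
  have "odd (w\<^sup>2)" using wt by (metis even_add even_mult_iff even_numeral even_power odd_one zero_less_numeral)
  then obtain v where "w = 2 * v + 1" by (auto elim: oddE)
  then have "x\<^sup>2 + t\<^sup>2 = m * (m + 1) - v * (v + 1)"
    using wt by (simp add: power2_eq_square algebra_simps)
  then have "even (x\<^sup>2 + t\<^sup>2)" by simp
  then have "even (x + t)" by simp
  with wt show ?thesis by (rule that)
qed

lemma even_squares_cong: "even s \<Longrightarrow> even t \<Longrightarrow> [1 + s\<^sup>2 + t\<^sup>2 = 1] (mod 4)" for s t :: int
  by (auto elim!: evenE simp: cong_iff_dvd_diff power2_eq_square)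

lemma odd_squares_cong: "odd s \<Longrightarrow> odd t \<Longrightarrow> [1 + s\<^sup>2 + t\<^sup>2 = 3] (mod 4)" for s t :: int
  by (auto elim!: oddE simp: cong_iff_dvd_diff power2_eq_square algebra_simps)

theorem theorem2p1:
  fixes m :: int
  assumes "m > 0"
  shows
    "(prime (2 * m + 1) \<and> [2 * m + 1 = 3] (mod 4) \<longrightarrow>
        (\<nexists>x y z :: int. T m = x^2 + y^2 + T z \<and> x^2 + y^2 > 0 \<and> [x = y] (mod 2)) \<and>
        (\<nexists>x y z :: int. 2 * T m = x^2 + T y + T z \<and> even x \<and> x \<noteq> 0))
     \<and>
     ((\<forall>p :: int. prime p \<and> p dvd 2 * m + 1 \<longrightarrow> [p = 1] (mod 4)) \<longrightarrow>
        (\<nexists>x y z :: int. T m = x^2 + y^2 + T z \<and> odd x \<and> even y) \<and>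
        (\<nexists>x y z :: int. 2 * T m = x^2 + T y + T z \<and> odd x))"
proof -
  let ?n = "2 * m + 1"
  have n: "?n > 0" "odd ?n" using assms by auto
  \<comment> \<open>Even \<open>s\<close> and \<open>t\<close> would make \<open>?n\<close>
    congruent to 1 modulo 4 instead of 3.\<close>
  have part1: False
    if p: "prime ?n" "[?n = 3] (mod 4)"
      and rep: "?n\<^sup>2 = w\<^sup>2 + 4 * (s\<^sup>2 + t\<^sup>2)" "s\<^sup>2 + t\<^sup>2 > 0" "even s" "even t" for w s t :: int
  proof -
    have "[?n = 1 + s\<^sup>2 + t\<^sup>2] (mod 4)"
      using square_eq_square_plus_4_sum_squares_mod_4[OF n rep(1,2)] p(1) primes_dvd_imp_eq by blast
    then have "[3 = 1] (mod (4 :: int))"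
      using p(2) even_squares_cong[OF rep(3,4)] cong_trans cong_sym by meson
    then show False by (simp add: cong_def)
  qed
  \<comment> \<open>Odd \<open>s\<close> and \<open>t\<close> would make \<open>?n\<close> congruent
    to 3 modulo 4, but its prime factors force 1.\<close>
  have part2: False
    if p: "\<forall>p. prime p \<and> p dvd ?n \<longrightarrow> [p = 1] (mod 4)"
      and rep: "?n\<^sup>2 = w\<^sup>2 + 4 * (s\<^sup>2 + t\<^sup>2)" "odd s" "odd t" for w s t :: int
  proof -
    have no3: "\<not> q dvd ?n" if "prime q" "[q = 3] (mod 4)" for q
      using p that by (auto simp: cong_def)
    have "s \<noteq> 0" using rep(2) by auto
    then have "s\<^sup>2 + t\<^sup>2 > 0" by (simp add: sum_power2_gt_zero_iff)
    then have "[?n = 1 + s\<^sup>2 + t\<^sup>2] (mod 4)"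
      using square_eq_square_plus_4_sum_squares_mod_4[OF n rep(1)] no3 by blast
    \<comment> \<open>Applied to the trivial sum of squares
      \<open>?n * ?n = ?n^2 + 0^2\<close>.\<close>
    moreover have "[?n = 1] (mod 4)"
      using odd_factor_of_sum_squares_cong_1[OF n, of ?n ?n 0] no3 by (simp add: power2_eq_square)
    ultimately have "[3 = 1] (mod (4 :: int))"
      using odd_squares_cong[OF rep(2,3)] cong_trans cong_sym by meson
    then show False by (simp add: cong_def)
  qed
  show ?thesis
  proof (intro conjI impI notI; elim exE conjE)
    fix x y z :: int
    assume p: "prime ?n" "[?n = 3] (mod 4)"
      and T: "T m = x\<^sup>2 + y\<^sup>2 + T z" and pos: "x\<^sup>2 + y\<^sup>2 > 0" and xy: "[x = y] (mod 2)"
    have "(x + y)\<^sup>2 + (x - y)\<^sup>2 > 0" using pos by (simp add: power2_eq_square algebra_simps)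
    moreover have "even (x - y)" using xy by (simp add: cong_iff_dvd_diff)
    moreover from this have "even (x + y)" by simp
    ultimately show False using part1[OF p T_eq_sum_squares_plus_T[OF T]] by blast
  next
    fix x y z :: int
    assume p: "prime ?n" "[?n = 3] (mod 4)"
      and T: "2 * T m = x\<^sup>2 + T y + T z" and x: "even x" "x \<noteq> 0"
    obtain w t where wt: "?n\<^sup>2 = w\<^sup>2 + 4 * (x\<^sup>2 + t\<^sup>2)" "even (x + t)"
      using double_T_eq_square_plus_T_plus_T[OF T] .
    show False
      using part1[OF p wt(1)] x wt(2) by (simp add: sum_power2_gt_zero_iff)
  next
    fix x y z :: int
    assume p: "\<forall>p. prime p \<and> p dvd ?n \<longrightarrow> [p = 1] (mod 4)"
      and T: "T m = x\<^sup>2 + y\<^sup>2 + T z" and "odd x" "even y"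
    \<comment> \<open>Opposite parities of \<open>x\<close> and \<open>y\<close> make both
      \<open>x + y\<close> and \<open>x - y\<close> odd.\<close>
    then show False using part2[OF p T_eq_sum_squares_plus_T[OF T]] by simp
  next
    fix x y z :: int
    assume p: "\<forall>p. prime p \<and> p dvd ?n \<longrightarrow> [p = 1] (mod 4)"
      and T: "2 * T m = x\<^sup>2 + T y + T z" and x: "odd x"
    obtain w t where wt: "?n\<^sup>2 = w\<^sup>2 + 4 * (x\<^sup>2 + t\<^sup>2)" "even (x + t)"
      using double_T_eq_square_plus_T_plus_T[OF T] .
    show False using part2[OF p wt(1)] x wt(2) by simp
  qed
qed

end
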